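(* Let $G$ be a finite group with $q=|G|$, and let $m\ge1$ and $2\le k\le q$ be integers. Then $$g_G(V(1,q,k))\le g_G(W(q,k))\le k-1$$ and $$g_G(V(m,q,k))\le g_G(V_1(m,q,k))\le g_G(V(m-1,q,q))+k-1\le (m-1)(q-1)+k-1.$$
   Context: For a topological space $Y$ the $k$-wise diagonal is $\Delta_q^k(Y)=\{(y_1,\dots,y_q)\in Y^q:\ y_{i_1}=\dots=y_{i_k}\text{ for some } i_1<\dots<i_k\}$, and the $k$-wise maximum diagonal is $$\Delta'^{\,k}_q(\mathbb R)=\{(y_1,\dots,y_q)\in\mathbb R^q:\ y_{i_1}=\dots=y_{i_k}=c\text{ for some } i_1<\dots<i_k\text{ and } c\in\mathbb R,\text{ and } y_j\le c\ \forall j\}.$$ Put $V(m,q,k)=(\mathbb R^m)^q\setminus\Delta_q^k(\mathbb R^m)$, $W(q,k)=\mathbb R^q\setminus\Delta'^{\,k}_q(\mathbb R)$, and, using $\mathbb R^m=\mathbb R\times\mathbb R^{m-1}$ so that $(\mathbb R^m)^q=\mathbb R^q\times(\mathbb R^{m-1})^q$, $$V_1(m,q,k)=(\mathbb R^m)^q\setminus\bigl(\Delta_q^k(\mathbb R)\times\Delta_q^q(\mathbb R^{m-1})\bigr).$$ For a finite group $G$ with $|G|=q$, the power $Y^q$ is identified (via a bijection of $G$ with the index set) with the space $\mathrm{Map}(G,Y)$ of all maps $G\to Y$, with the left $G$-action $(g\phi)(h)=\phi(g^{-1}h)$; the subspaces $V(m,q,k)$ and $V_1(m,q,k)$ of $(\mathbb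 R^m)^q$ and the subspace $W(q,k)$ of $\mathbb R^q$ are $G$-invariant. A $G$-space is fixed point free if no point is fixed by all of $G$. Let $D_G$ be the (discrete) disjoint union of all orbits $G/H$ over subgroups $H\ne G$. The fixed point free genus $g_G(X)$ of a fixed point free $G$-space $X$ is the least $n\ge0$ such that $X$ can be covered by $n$ ($G$-invariant) open subsets $X_1,\dots,X_n$, each admitting a $G$-equivariant continuous map $X_i\to D_G$ ($\infty$ if there is no such $n$; the empty space has genus $0$). *)

theory Defs
  imports
    "HOL-Analysis.Analysis"
    "HOL-Algebra.Left_Coset"
    "HOL-Library.Extended_Nat"
begin

text \<open>All groups \<open>G\<close> below are finite, with the discrete topology, so a \<open>G\<close>-space is a
  topological space on which each group element acts by a continuous map.\<close>

definition G_space ::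
    "('a, 'b) monoid_scheme \<Rightarrow> 'x topology \<Rightarrow> ('a \<Rightarrow> 'x \<Rightarrow> 'x) \<Rightarrow> bool" where
  "G_space G X act \<longleftrightarrow>
     (\<forall>g\<in>carrier G. continuous_map X X (act g)) \<and>
     (\<forall>x\<in>topspace X. act \<one>\<^bsub>G\<^esub> x = x) \<and>
     (\<forall>g\<in>carrier G. \<forall>h\<in>carrier G. \<forall>x\<in>topspace X. act (g \<otimes>\<^bsub>G\<^esub> h) x = act g (act h x))"

definition fixed_point_free ::
    "('a, 'b) monoid_scheme \<Rightarrow> 'x topology \<Rightarrow> ('a \<Rightarrow> 'x \<Rightarrow> 'x) \<Rightarrow> bool" where
  "fixed_point_free G X act \<longleftrightarrow> \<not> (\<exists>x\<in>topspace X. \<forall>g\<in>carrier G. act g x = x)"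

text \<open>A point of the disjoint union of the orbits \<open>G/H\<close> is a pair consisting of a subgroup
  \<open>H \<noteq> G\<close> and a left coset of \<open>H\<close>.\<close>

definition orbit_union :: "('a, 'b) monoid_scheme \<Rightarrow> ('a set \<times> 'a set) topology" where
  "orbit_union G =
     discrete_topology (SIGMA H : {H. subgroup H G \<and> H \<noteq> carrier G}. lcosets\<^bsub>G\<^esub> H)"

definition orbit_union_act ::
    "('a, 'b) monoid_scheme \<Rightarrow> 'a \<Rightarrow> 'a set \<times> 'a set \<Rightarrow> 'a set \<times> 'a set" where
  "orbit_union_act G g = (\<lambda>(H, C). (H, g <#\<^bsub>G\<^esub> C))"

definition fpf_genus_le ::
    "('a, 'b) monoid_scheme \<Rightarrow> 'x topology \<Rightarrow> ('a \<Rightarrow> 'x \<Rightarrow> 'x) \<Rightarrow> nat \<Rightarrow> bool" where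
  "fpf_genus_le G X act n \<longleftrightarrow>
     (\<exists>U. topspace X = (\<Union>i<n. U i) \<and>
       (\<forall>i<n. openin X (U i) \<and>
              (\<forall>g\<in>carrier G. \<forall>x\<in>U i. act g x \<in> U i) \<and>
              (\<exists>f. continuous_map (subtopology X (U i)) (orbit_union G) f \<and>
                   (\<forall>g\<in>carrier G. \<forall>x\<in>U i. f (act g x) = orbit_union_act G g (f x)))))"

text \<open>\<open>Inf {} = \<infinity>\<close> in \<^typ>\<open>enat\<close>.\<close>

definition fpf_genus ::
    "('a, 'b) monoid_scheme \<Rightarrow> 'x topology \<Rightarrow> ('a \<Rightarrow> 'x \<Rightarrow> 'x) \<Rightarrow> enat" where
  "fpf_genus G X act = Inf (enat ` {n. fpf_genus_le G X act n})"

text \<open>The power \<open>Y\<^sup>q\<close> is the space of maps \<open>G \<rightarrow> Y\<close>, represented by functions that are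
  extensional on \<^term>\<open>carrier G\<close>. The action below serves the full power and all its invariant
  subspaces.\<close>

definition map_space :: "('a, 'b) monoid_scheme \<Rightarrow> 'y topology \<Rightarrow> ('a \<Rightarrow> 'y) topology" where
  "map_space G Y = product_topology (\<lambda>_. Y) (carrier G)"

definition map_act :: "('a, 'b) monoid_scheme \<Rightarrow> 'a \<Rightarrow> ('a \<Rightarrow> 'y) \<Rightarrow> ('a \<Rightarrow> 'y)" where
  "map_act G g \<phi> = (\<lambda>h\<in>carrier G. \<phi> (inv\<^bsub>G\<^esub> g \<otimes>\<^bsub>G\<^esub> h))"

text \<open>The set \<open>S\<close> plays the role of the \<open>k\<close> distinct indices \<open>i\<^sub>1 < \<dots> < i\<^sub>k\<close>.\<close>

definition kdiag :: "('a, 'b) monoid_scheme \<Rightarrow> nat \<Rightarrow> 'y topology \<Rightarrow> ('a \<Rightarrow> 'y) set" where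
  "kdiag G k Y =
     {y \<in> topspace (map_space G Y).
        \<exists>S. S \<subseteq> carrier G \<and> card S = k \<and> (\<forall>i\<in>S. \<forall>j\<in>S. y i = y j)}"

definition kdiag_max :: "('a, 'b) monoid_scheme \<Rightarrow> nat \<Rightarrow> ('a \<Rightarrow> real) set" where
  "kdiag_max G k =
     {y \<in> topspace (map_space G euclideanreal).
        \<exists>S c. S \<subseteq> carrier G \<and> card S = k \<and> (\<forall>i\<in>S. y i = c) \<and> (\<forall>j\<in>carrier G. y j \<le> c)}"

text \<open>In \<open>V G m k\<close>, \<open>V\<^sub>1 G m k\<close> and \<open>W G k\<close> the number \<open>q\<close> is \<^term>\<open>order G\<close>.
  The space \<^term>\<open>Euclidean_space m\<close> consists of the real sequences vanishing from index \<open>m\<close> on;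
  \<open>m = 0\<close> is allowed and gives a point.\<close>

definition V :: "('a, 'b) monoid_scheme \<Rightarrow> nat \<Rightarrow> nat \<Rightarrow> ('a \<Rightarrow> nat \<Rightarrow> real) topology" where
  "V G m k =
     subtopology (map_space G (Euclidean_space m)) (- kdiag G k (Euclidean_space m))"

definition W :: "('a, 'b) monoid_scheme \<Rightarrow> nat \<Rightarrow> ('a \<Rightarrow> real) topology" where
  "W G k = subtopology (map_space G euclideanreal) (- kdiag_max G k)"

text \<open>The homeomorphism of \<open>\<real>\<^sup>m\<close> with \<open>\<real> \<times> \<real>\<^sup>m\<^sup>-\<^sup>1\<close> (for \<open>m \<ge> 1\<close>) sends \<open>x\<close> to \<open>x 0\<close> and the
  shifted sequence \<open>\<lambda>i. x (Suc i)\<close>.\<close>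

definition V\<^sub>1 :: "('a, 'b) monoid_scheme \<Rightarrow> nat \<Rightarrow> nat \<Rightarrow> ('a \<Rightarrow> nat \<Rightarrow> real) topology" where
  "V\<^sub>1 G m k =
     subtopology (map_space G (Euclidean_space m))
       (- {\<phi>. ((\<lambda>h\<in>carrier G. \<phi> h 0), (\<lambda>h\<in>carrier G. \<lambda>i. \<phi> h (Suc i)))
              \<in> kdiag G k euclideanreal \<times> kdiag G (order G) (Euclidean_space (m - 1))})"

text \<open>The spaces to which the genus is applied are fixed point free \<open>G\<close>-spaces.\<close>

lemma G_space_map_space:
  fixes G (structure)
  assumes "Group.group G"
  shows "G_space G (map_space G Y) (map_act G)"
proof -
  interpret group G by fact
  have cont: "continuous_map (map_space G Y) (map_space G Y) (map_act G g)"
    if g: "g \<in> carrier G" for g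
    unfolding map_space_def
  proof (subst continuous_map_componentwise, intro conjI ballI)
    show "map_act G g ` topspace (product_topology (\<lambda>_. Y) (carrier G)) \<subseteq> extensional (carrier G)"
      by (auto simp: map_act_def)
    fix h assume h: "h \<in> carrier G"
    then have "inv g \<otimes> h \<in> carrier G" using g by simp
    then show "continuous_map (product_topology (\<lambda>_. Y) (carrier G)) Y (\<lambda>x. map_act G g x h)"
      using h continuous_map_product_projection[of "inv g \<otimes> h" "carrier G" "\<lambda>_. Y"]
      by (simp add: map_act_def)
  qed
  have "map_act G \<one> x = x" if "x \<in> topspace (map_space G Y)" for x
    using that by (auto simp: map_act_def map_space_def PiE_def extensional_def fun_eq_iff)
  moreover have "map_act G (g \<otimes> h) x = map_act G g (map_act G h x)"
    if "g \<in> carrier G" "h \<in> carrier G" for g h and x :: "'a \<Rightarrow> 'c"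
    using that by (auto simp: map_act_def fun_eq_iff restrict_def inv_mult_group m_assoc)
  ultimately show ?thesis
    using cont by (simp add: G_space_def)
qed

lemma G_space_subtopology:
  assumes "G_space G X act" and "\<And>g x. g \<in> carrier G \<Longrightarrow> x \<in> topspace X \<Longrightarrow> x \<in> S \<Longrightarrow> act g x \<in> S"
  shows "G_space G (subtopology X S) act"
  using assms unfolding G_space_def
  by (auto simp: continuous_map_in_subtopology continuous_map_from_subtopology)

lemma map_act_in_space:
  fixes G (structure)
  assumes "Group.group G" "g \<in> carrier G" "x \<in> topspace (map_space G Y)"
  shows "map_act G g x \<in> topspace (map_space G Y)"
  using G_space_map_space[OF assms(1), of Y] assms(2,3)
  by (auto simp: G_space_def continuous_map_def)

lemma map_act_inverse:
  fixes G (structure)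
  assumes "Group.group G" "g \<in> carrier G" "x \<in> topspace (map_space G Y)"
  shows "map_act G (inv\<^bsub>G\<^esub> g) (map_act G g x) = x"
proof -
  interpret group G by fact
  show ?thesis
    using G_space_map_space[OF assms(1), of Y] assms(2,3)
    unfolding G_space_def by (metis inv_closed l_inv)
qed

lemma translate_indices:
  fixes G (structure)
  assumes "Group.group G" "g \<in> carrier G" "S \<subseteq> carrier G"
  shows "(\<lambda>h. g \<otimes>\<^bsub>G\<^esub> h) ` S \<subseteq> carrier G" "card ((\<lambda>h. g \<otimes>\<^bsub>G\<^esub> h) ` S) = card S"
    "\<And>h. h \<in> S \<Longrightarrow> map_act G g y (g \<otimes>\<^bsub>G\<^esub> h) = y h"
proof -
  interpret group G by fact
  show "(\<lambda>h. g \<otimes> h) ` S \<subseteq> carrier G"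
    using assms by auto
  show "card ((\<lambda>h. g \<otimes> h) ` S) = card S"
    by (rule card_image) (meson assms inj_on_cmult inj_on_subset)
  show "map_act G g y (g \<otimes> h) = y h" if "h \<in> S" for h
  proof -
    have "inv g \<otimes> (g \<otimes> h) = h"
      using that assms by (metis inv_closed l_inv l_one m_assoc subsetD)
    then show ?thesis
      using that assms by (auto simp: map_act_def)
  qed
qed

lemma map_act_kdiag:
  fixes G (structure)
  assumes "Group.group G" "g \<in> carrier G" "x \<in> kdiag G k Y"
  shows "map_act G g x \<in> kdiag G k Y"
proof -
  obtain S where S: "S \<subseteq> carrier G" "card S = k" "\<forall>i\<in>S. \<forall>j\<in>S. x i = x j"
    using assms(3) by (auto simp: kdiag_def)
  note t = translate_indices[OF assms(1,2) S(1)]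
  have "\<forall>i\<in>(\<lambda>h. g \<otimes>\<^bsub>G\<^esub> h) ` S. \<forall>j\<in>(\<lambda>h. g \<otimes>\<^bsub>G\<^esub> h) ` S. map_act G g x i = map_act G g x j"
  proof (intro ballI, elim imageE)
    fix i j h h' assume "i = g \<otimes> h" "h \<in> S" "j = g \<otimes> h'" "h' \<in> S"
    moreover from this have "x h = x h'" using S(3) by blast
    ultimately show "map_act G g x i = map_act G g x j" by (simp only: t(3))
  qed
  then show ?thesis
    using t(1,2) S(2) assms map_act_in_space[OF assms(1,2)] unfolding kdiag_def by blast
qed

lemma map_act_kdiag_max:
  fixes G (structure)
  assumes "Group.group G" "g \<in> carrier G" "x \<in> kdiag_max G k"
  shows "map_act G g x \<in> kdiag_max G k"
proof -
  interpret group G by fact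
  obtain S c where S: "S \<subseteq> carrier G" "card S = k" "\<forall>i\<in>S. x i = c" "\<forall>j\<in>carrier G. x j \<le> c"
    using assms(3) by (auto simp: kdiag_max_def)
  note t = translate_indices[OF assms(1,2) S(1)]
  have "\<forall>i\<in>(\<lambda>h. g \<otimes> h) ` S. map_act G g x i = c"
    using S(3) by (auto simp: t(3))
  moreover have "\<forall>j\<in>carrier G. map_act G g x j \<le> c"
    using S(4) assms(2) by (auto simp: map_act_def)
  ultimately show ?thesis
    using t(1,2) S(2) assms map_act_in_space[OF assms(1,2)] unfolding kdiag_max_def by blast
qed

lemma map_act_fixed_const:
  fixes G (structure)
  assumes "Group.group G" "\<forall>g\<in>carrier G. map_act G g x = x" "h \<in> carrier G"
  shows "x h = x \<one>\<^bsub>G\<^esub>"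
proof -
  interpret group G by fact
  have "map_act G h x h = x \<one>"
    using assms(3) by (simp add: map_act_def)
  then show ?thesis
    using assms by simp
qed

lemma const_kdiag:
  assumes "k \<le> order G" "x \<in> topspace (map_space G Y)" "\<And>h. h \<in> carrier G \<Longrightarrow> x h = c"
  shows "x \<in> kdiag G k Y"
proof -
  obtain S where "S \<subseteq> carrier G" "card S = k"
    using assms(1) by (metis obtain_subset_with_card_n order_def)
  then show ?thesis
    using assms(2,3) unfolding kdiag_def by (auto intro!: exI[of _ S] simp: subset_iff)
qed

lemma const_kdiag_max:
  assumes "k \<le> order G" "x \<in> topspace (map_space G euclideanreal)"
    "\<And>h. h \<in> carrier G \<Longrightarrow> x h = c"
  shows "x \<in> kdiag_max G k"
proof -
  obtain S where "S \<subseteq> carrier G" "card S = k"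
    using assms(1) by (metis obtain_subset_with_card_n order_def)
  then show ?thesis
    using assms(2,3) unfolding kdiag_max_def by (auto intro!: exI[of _ S] exI[of _ c] simp: subset_iff)
qed

lemma V_fixed_point_free:
  fixes G (structure)
  assumes "Group.group G" "k \<le> order G"
  shows "G_space G (V G m k) (map_act G)" "fixed_point_free G (V G m k) (map_act G)"
proof -
  interpret group G by fact
  show "G_space G (V G m k) (map_act G)"
    unfolding V_def
  proof (rule G_space_subtopology[OF G_space_map_space[OF assms(1)]])
    fix g x
    assume *: "g \<in> carrier G" "x \<in> topspace (map_space G (Euclidean_space m))"
      "x \<in> - kdiag G k (Euclidean_space m)"
    then show "map_act G g x \<in> - kdiag G k (Euclidean_space m)"
      using map_act_kdiag[OF assms(1) inv_closed[OF *(1)]] map_act_inverse[OF assms(1) *(1,2)]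
      by (metis ComplD ComplI)
  qed
  have "x \<in> kdiag G k (Euclidean_space m)" if x: "x \<in> topspace (map_space G (Euclidean_space m))"
    "\<forall>g\<in>carrier G. map_act G g x = x" for x
    by (rule const_kdiag[OF assms(2) x(1) map_act_fixed_const[OF assms(1) x(2)]])
  then show "fixed_point_free G (V G m k) (map_act G)"
    by (auto simp: fixed_point_free_def V_def)
qed

lemma W_fixed_point_free:
  fixes G (structure)
  assumes "Group.group G" "k \<le> order G"
  shows "G_space G (W G k) (map_act G)" "fixed_point_free G (W G k) (map_act G)"
proof -
  interpret group G by fact
  show "G_space G (W G k) (map_act G)"
    unfolding W_def
  proof (rule G_space_subtopology[OF G_space_map_space[OF assms(1)]])
    fix g x
    assume *: "g \<in> carrier G" "x \<in> topspace (map_space G euclideanreal)"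
      "x \<in> - kdiag_max G k"
    then show "map_act G g x \<in> - kdiag_max G k"
      using map_act_kdiag_max[OF assms(1) inv_closed[OF *(1)]] map_act_inverse[OF assms(1) *(1,2)]
      by (metis ComplD ComplI)
  qed
  have "x \<in> kdiag_max G k" if x: "x \<in> topspace (map_space G (euclideanreal))"
    "\<forall>g\<in>carrier G. map_act G g x = x" for x
    by (rule const_kdiag_max[OF assms(2) x(1) map_act_fixed_const[OF assms(1) x(2)]])
  then show "fixed_point_free G (W G k) (map_act G)"
    by (auto simp: fixed_point_free_def W_def)
qed

lemma V\<^sub>1_fixed_point_free:
  fixes G (structure)
  assumes "Group.group G" "k \<le> order G" "m \<ge> 1"
  shows "G_space G (V\<^sub>1 G m k) (map_act G)" "fixed_point_free G (V\<^sub>1 G m k) (map_act G)"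
proof -
  interpret group G by fact
  define p where "p = (\<lambda>\<phi> :: 'a \<Rightarrow> nat \<Rightarrow> real. \<lambda>h\<in>carrier G. \<phi> h 0)"
  define r where "r = (\<lambda>\<phi> :: 'a \<Rightarrow> nat \<Rightarrow> real. \<lambda>h\<in>carrier G. \<lambda>i. \<phi> h (Suc i))"
  define D where "D = {\<phi>. (p \<phi>, r \<phi>)
              \<in> kdiag G k euclideanreal \<times> kdiag G (order G) (Euclidean_space (m - 1))}"
  have V1: "V\<^sub>1 G m k = subtopology (map_space G (Euclidean_space m)) (- D)"
    by (simp add: V\<^sub>1_def D_def p_def r_def)
  have p: "p (map_act G g x) = map_act G g (p x)" and r: "r (map_act G g x) = map_act G g (r x)"
    if "g \<in> carrier G" for g x
    using that by (auto simp: p_def r_def map_act_def fun_eq_iff)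
  have D: "map_act G g x \<in> D" if "g \<in> carrier G" "x \<in> D" for g x
    using that by (auto simp: D_def p r intro: map_act_kdiag[OF assms(1)])
  show "G_space G (V\<^sub>1 G m k) (map_act G)"
    unfolding V1
  proof (rule G_space_subtopology[OF G_space_map_space[OF assms(1)]])
    fix g x
    assume *: "g \<in> carrier G" "x \<in> topspace (map_space G (Euclidean_space m))" "x \<in> - D"
    then show "map_act G g x \<in> - D"
      using D[OF inv_closed[OF *(1)]] map_act_inverse[OF assms(1) *(1,2)]
      by (metis ComplD ComplI)
  qed
  have "x \<in> D" if x: "x \<in> topspace (map_space G (Euclidean_space m))"
    "\<forall>g\<in>carrier G. map_act G g x = x" for x
  proof -
    obtain c where c: "\<And>h. h \<in> carrier G \<Longrightarrow> x h = c"
      using map_act_fixed_const[OF assms(1) x(2)] by blast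
    then have "c \<in> topspace (Euclidean_space m)"
      using x(1) one_closed by (force simp: map_space_def)
    then have shift: "(\<lambda>i. c (Suc i)) \<in> topspace (Euclidean_space (m - 1))"
      using assms(3) by (simp add: topspace_Euclidean_space)
    have "p x \<in> kdiag G k euclideanreal"
      by (rule const_kdiag[OF assms(2), where c = "c 0"])
        (auto simp: p_def map_space_def c)
    moreover have "r x \<in> kdiag G (order G) (Euclidean_space (m - 1))"
      by (rule const_kdiag[where c = "\<lambda>i. c (Suc i)"])
        (use shift in \<open>auto simp: r_def map_space_def c\<close>)
    ultimately show ?thesis
      by (simp add: D_def)
  qed
  then show "fixed_point_free G (V\<^sub>1 G m k) (map_act G)"
    by (auto simp: fixed_point_free_def V1)
qed

end

theory Submission
  imports Defs
begin

text \<open>The genus is monotone along equivariant maps \<open>X \<rightarrow> Y\<close>, since covers and maps to orbits pull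
  back, and it is subadditive for invariant open sets \<open>X = A \<union> B\<close>. With these two principles
  (\<open>fpf_genus_mono\<close>, \<open>fpf_genus_le_Un\<close>) every inequality reduces to the estimate for \<open>W\<close>.

  A point \<open>y\<close> of \<open>W(q,k)\<close> is a real function on \<open>G\<close> that attains its maximum \<open>n\<close> times
  for some \<open>1 \<le> n \<le> k - 1\<close>. Let \<open>U\<^sub>n\<close> be the set of all \<open>y\<close> for which some \<open>n\<close>-element set
  \<open>S \<subseteq> G\<close> carries values strictly above all others. This condition is open and invariant under
  translation, \<open>S\<close> is determined by \<open>y\<close> and \<open>n\<close>, and \<open>y \<mapsto> S\<close> is locally constant and
  equivariant. For \<open>0 < n < q\<close> no \<open>n\<close>-element set is invariant under all translations, so the
  discrete set of these \<open>S\<close> maps equivariantly to proper orbits. Hence \<open>U\<^sub>1, \<dots>, U\<^sub>k\<^sub>-\<^sub>1\<close> cover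
  \<open>W(q,k)\<close> as required (\<open>W_genus_le\<close>).

  The inclusions \<open>V(1,q,k) \<subseteq> W(q,k)\<close> and \<open>V(m,q,k) \<subseteq> V\<^sub>1(m,q,k)\<close> are equivariant and give the
  inequalities between the genera of these spaces.
  A point \<open>\<phi>\<close> of \<open>V\<^sub>1(m,q,k)\<close> has a first coordinate without \<open>k\<close> equal values, or
  remaining coordinates that are not constant on \<open>G\<close>. The first condition defines an open set mapping
  to \<open>W(q,k)\<close>, the second one mapping to \<open>V(m-1,q,q)\<close>; subadditivity yields
  \<open>V\<^sub>1_genus_le\<close>. Its case \<open>k = q\<close>, combined with \<open>V \<subseteq> V\<^sub>1\<close>, gives the last bound by induction on
  the dimension, starting from the empty space \<open>V(0,q,q)\<close>.\<close>

section \<open>The genus and equivariant maps\<close>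

definition equivariant_map ::
    "('a, 'b) monoid_scheme \<Rightarrow> 'x topology \<Rightarrow> ('a \<Rightarrow> 'x \<Rightarrow> 'x) \<Rightarrow>
     'y topology \<Rightarrow> ('a \<Rightarrow> 'y \<Rightarrow> 'y) \<Rightarrow> ('x \<Rightarrow> 'y) \<Rightarrow> bool" where
  "equivariant_map G X actX Y actY f \<longleftrightarrow>
     continuous_map X Y f \<and>
     (\<forall>g\<in>carrier G. \<forall>x\<in>topspace X. f (actX g x) = actY g (f x))"

lemma fpf_genus_leI: "fpf_genus_le G X act n \<Longrightarrow> fpf_genus G X act \<le> enat n"
  unfolding fpf_genus_def by (rule Inf_lower) simp

text \<open>The infimum defining a finite genus is attained, so such a genus comes with a cover.\<close>

lemma fpf_genus_finite_obtain:
  assumes "fpf_genus G X act \<noteq> \<infinity>"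
  obtains n where "fpf_genus G X act = enat n" "fpf_genus_le G X act n"
proof -
  have "enat ` {n. fpf_genus_le G X act n} \<noteq> {}"
  proof
    assume "enat ` {n. fpf_genus_le G X act n} = {}"
    then have "fpf_genus G X act = \<infinity>"
      unfolding fpf_genus_def by (simp only: Inf_enat_def simp_thms if_True)
    then show False
      using assms by simp
  qed
  then have "fpf_genus G X act \<in> enat ` {n. fpf_genus_le G X act n}"
    unfolding fpf_genus_def Inf_enat_def by (simp only: if_False) (metis LeastI ex_in_conv)
  then show ?thesis
    using that by blast
qed

lemma G_space_act_closed:
  "G_space G X act \<Longrightarrow> g \<in> carrier G \<Longrightarrow> x \<in> topspace X \<Longrightarrow> act g x \<in> topspace X"
  using continuous_map_image_subset_topspace[of X X "act g"] unfolding G_space_def by blast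

text \<open>The members of the covers that are counted by the genus.\<close>

definition orbit_chart ::
    "('a, 'b) monoid_scheme \<Rightarrow> 'x topology \<Rightarrow> ('a \<Rightarrow> 'x \<Rightarrow> 'x) \<Rightarrow> 'x set \<Rightarrow> bool" where
  "orbit_chart G X act U \<longleftrightarrow>
     openin X U \<and> (\<forall>g\<in>carrier G. \<forall>x\<in>U. act g x \<in> U) \<and>
     (\<exists>f. equivariant_map G (subtopology X U) act (orbit_union G) (orbit_union_act G) f)"

lemma fpf_genus_le_iff_charts:
  "fpf_genus_le G X act n \<longleftrightarrow>
     (\<exists>U. topspace X = (\<Union>i<n. U i) \<and> (\<forall>i<n. orbit_chart G X act (U i)))"
proof -
  have "orbit_chart G X act U \<longleftrightarrow>
      openin X U \<and> (\<forall>g\<in>carrier G. \<forall>x\<in>U. act g x \<in> U) \<and>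
      (\<exists>f. continuous_map (subtopology X U) (orbit_union G) f \<and>
         (\<forall>g\<in>carrier G. \<forall>x\<in>U. f (act g x) = orbit_union_act G g (f x)))" for U
  proof (cases "openin X U")
    case True
    then show ?thesis
      using openin_subset[OF True]
      by (simp add: orbit_chart_def equivariant_map_def topspace_subtopology_subset Int_absorb1)
  qed (simp add: orbit_chart_def)
  then show ?thesis
    by (simp only: fpf_genus_le_def)
qed

lemma equivariant_map_compose:
  assumes "equivariant_map G X actX Y actY f" "equivariant_map G Y actY Z actZ e"
  shows "equivariant_map G X actX Z actZ (e \<circ> f)"
  using assms continuous_map_compose[of X Y f Z e] continuous_map_funspace[of X Y f]
  by (auto simp: equivariant_map_def Pi_iff)

lemma equivariant_map_subspaces:
  assumes "equivariant_map G X actX Y actY f"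
    and "\<And>x. x \<in> topspace X \<Longrightarrow> x \<in> A \<Longrightarrow> f x \<in> B"
  shows "equivariant_map G (subtopology X A) actX (subtopology Y B) actY f"
  using assms unfolding equivariant_map_def
  by (auto simp: continuous_map_in_subtopology continuous_map_from_subtopology)

lemma orbit_chart_preimage:
  assumes f: "equivariant_map G X actX Y actY f"
    and X: "\<And>g x. g \<in> carrier G \<Longrightarrow> x \<in> topspace X \<Longrightarrow> actX g x \<in> topspace X"
    and U: "orbit_chart G Y actY U"
  shows "orbit_chart G X actX {x \<in> topspace X. f x \<in> U}"
proof -
  let ?P = "{x \<in> topspace X. f x \<in> U}"
  obtain e where e: "equivariant_map G (subtopology Y U) actY (orbit_union G) (orbit_union_act G) e"
    using U by (auto simp: orbit_chart_def)
  have "equivariant_map G (subtopology X ?P) actX (subtopology Y U) actY f"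
    using f by (rule equivariant_map_subspaces) simp
  then have "equivariant_map G (subtopology X ?P) actX (orbit_union G) (orbit_union_act G) (e \<circ> f)"
    using e by (rule equivariant_map_compose)
  moreover have "openin X ?P"
    using f U by (auto simp: equivariant_map_def orbit_chart_def intro: openin_continuous_map_preimage)
  moreover have "\<forall>g\<in>carrier G. \<forall>x\<in>?P. actX g x \<in> ?P"
    using f X U by (auto simp: equivariant_map_def orbit_chart_def)
  ultimately show ?thesis
    unfolding orbit_chart_def by blast
qed

lemma orbit_chart_of_open:
  assumes "openin X C" "orbit_chart G (subtopology X C) act U"
  shows "orbit_chart G X act U"
proof -
  have "openin X U" "U \<subseteq> C"
    using assms openin_open_subtopology[OF assms(1)] by (auto simp: orbit_chart_def)
  moreover from this have "subtopology (subtopology X C) U = subtopology X U"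
    by (simp add: subtopology_subtopology Int_absorb1)
  ultimately show ?thesis
    using assms(2) by (simp add: orbit_chart_def)
qed

text \<open>Charts of an open subspace are charts of the whole space, because openness is transitive and
  iterated subspaces agree with subspaces.\<close>

lemma orbit_charts_of_open:
  assumes C: "openin X C" and le: "fpf_genus_le G (subtopology X C) act n"
  shows "\<exists>U. C = (\<Union>i<n. U i) \<and> (\<forall>i<n. orbit_chart G X act (U i))"
proof -
  have "topspace (subtopology X C) = C"
    using openin_subset[OF C] by (rule topspace_subtopology_subset)
  with le obtain U where "C = (\<Union>i<n. U i)" "\<forall>i<n. orbit_chart G (subtopology X C) act (U i)"
    unfolding fpf_genus_le_iff_charts by auto
  then show ?thesis
    using orbit_chart_of_open[OF C] by blast
qed

lemma fpf_genus_le_pullback: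
  assumes f: "equivariant_map G X actX Y actY f"
    and X: "\<And>g x. g \<in> carrier G \<Longrightarrow> x \<in> topspace X \<Longrightarrow> actX g x \<in> topspace X"
    and Y: "fpf_genus_le G Y actY n"
  shows "fpf_genus_le G X actX n"
proof -
  obtain U where U: "topspace Y = (\<Union>i<n. U i)" "\<And>i. i < n \<Longrightarrow> orbit_chart G Y actY (U i)"
    using Y unfolding fpf_genus_le_iff_charts by blast
  have "f x \<in> topspace Y" if "x \<in> topspace X" for x
    using f that continuous_map_funspace[of X Y f] by (auto simp: equivariant_map_def)
  then have "topspace X = (\<Union>i<n. {x \<in> topspace X. f x \<in> U i})"
    using U(1) by auto
  then show ?thesis
    unfolding fpf_genus_le_iff_charts using orbit_chart_preimage[OF f X U(2)]
    by (intro exI[of _ "\<lambda>i. {x \<in> topspace X. f x \<in> U i}"]) blast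
qed

lemma fpf_genus_mono:
  assumes "equivariant_map G X actX Y actY f"
    and "\<And>g x. g \<in> carrier G \<Longrightarrow> x \<in> topspace X \<Longrightarrow> actX g x \<in> topspace X"
  shows "fpf_genus G X actX \<le> fpf_genus G Y actY"
proof (cases "fpf_genus G Y actY = \<infinity>")
  case False
  then obtain n where "fpf_genus G Y actY = enat n" "fpf_genus_le G Y actY n"
    by (rule fpf_genus_finite_obtain)
  then show ?thesis
    using fpf_genus_leI[OF fpf_genus_le_pullback[OF assms]] by simp
qed simp

text \<open>Concatenating a cover of \<open>A\<close> with a cover of \<open>B\<close> covers \<open>A \<union> B\<close>.\<close>

lemma fpf_genus_le_Un:
  assumes A: "openin X A" and B: "openin X B" and top: "topspace X = A \<union> B"
    and a: "fpf_genus_le G (subtopology X A) act a" and b: "fpf_genus_le G (subtopology X B) act b"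
  shows "fpf_genus_le G X act (a + b)"
proof -
  obtain UA where UA: "A = (\<Union>i<a. UA i)" "\<And>i. i < a \<Longrightarrow> orbit_chart G X act (UA i)"
    using orbit_charts_of_open[OF A a] by blast
  obtain UB where UB: "B = (\<Union>i<b. UB i)" "\<And>i. i < b \<Longrightarrow> orbit_chart G X act (UB i)"
    using orbit_charts_of_open[OF B b] by blast
  \<comment> \<open>The sets of the second cover are renumbered to follow the first.\<close>
  define U where "U i = (if i < a then UA i else UB (i - a))" for i
  have "(\<Union>i<a. U i) = A" "(\<Union>i\<in>(+) a ` {..<b}. U i) = B"
    by (auto simp: UA(1) UB(1) U_def)
  moreover have "{..<a + b} = {..<a} \<union> (+) a ` {..<b}"
    by (auto simp: image_iff Bex_def) presburger
  ultimately have "topspace X = (\<Union>i<a + b. U i)"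
    by (simp only: UN_Un top)
  moreover have "orbit_chart G X act (U i)" if "i < a + b" for i
    using that UA(2) UB(2) by (simp add: U_def)
  ultimately show ?thesis
    unfolding fpf_genus_le_iff_charts by blast
qed

section \<open>Discrete fixed point free sets\<close>

context group
begin

lemma l_coset_image: "g <# S = (\<lambda>h. g \<otimes> h) ` S"
  by (auto simp: l_coset_def)

text \<open>After a choice of a base point \<open>r\<close> in each orbit, a point \<open>x\<close> goes to the set of all group
  elements that carry \<open>r\<close> to \<open>x\<close>. This is a left coset of the stabilizer of \<open>r\<close>, which is a proper
  subgroup as \<open>r\<close> is not fixed.\<close>

lemma fixed_point_free_set_to_orbits:
  assumes closed: "\<And>g x. g \<in> carrier G \<Longrightarrow> x \<in> T \<Longrightarrow> act g x \<in> T"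
    and one: "\<And>x. x \<in> T \<Longrightarrow> act \<one> x = x"
    and mult: "\<And>g h x. g \<in> carrier G \<Longrightarrow> h \<in> carrier G \<Longrightarrow> x \<in> T \<Longrightarrow>
                  act (g \<otimes> h) x = act g (act h x)"
    and fpf: "\<And>x. x \<in> T \<Longrightarrow> \<exists>g\<in>carrier G. act g x \<noteq> x"
  obtains e where "\<And>x. x \<in> T \<Longrightarrow> e x \<in> topspace (orbit_union G)"
    "\<And>g x. g \<in> carrier G \<Longrightarrow> x \<in> T \<Longrightarrow> e (act g x) = orbit_union_act G g (e x)"
proof -
  define orb where "orb x = (\<lambda>g. act g x) ` carrier G" for x
  \<comment> \<open>The base point depends on \<open>x\<close> through its orbit only, hence is the same for \<open>act g x\<close>.\<close>
  define r where "r x = (SOME y. y \<in> orb x)" for x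
  define stab where "stab x = {g \<in> carrier G. act g x = x}" for x
  define trans where "trans y x = {g \<in> carrier G. act g y = x}" for y x
  define e where "e x = (stab (r x), trans (r x) x)" for x
  have undo: "act (inv g) (act g x) = x" if "g \<in> carrier G" "x \<in> T" for g x
    using that mult[of "inv g" g x] one by simp
  have r: "r x \<in> orb x" for x
    unfolding r_def by (rule someI[of _ "act \<one> x"]) (auto simp: orb_def)
  have orb_act: "orb (act g x) = orb x" if gx: "g \<in> carrier G" "x \<in> T" for g x
  proof
    show "orb (act g x) \<subseteq> orb x"
      unfolding orb_def
    proof (rule image_subsetI)
      fix h assume "h \<in> carrier G"
      then show "act h (act g x) \<in> (\<lambda>h. act h x) ` carrier G"
        using gx by (intro rev_image_eqI[of "h \<otimes> g"]) (simp_all add: mult)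
    qed
    show "orb x \<subseteq> orb (act g x)"
      unfolding orb_def
    proof (rule image_subsetI)
      fix h assume "h \<in> carrier G"
      then show "act h x \<in> (\<lambda>h. act h (act g x)) ` carrier G"
        using gx by (intro rev_image_eqI[of "h \<otimes> inv g"]) (simp_all add: mult closed undo)
    qed
  qed
  have stab: "subgroup (stab x) G \<and> stab x \<noteq> carrier G" if "x \<in> T" for x
  proof
    show "subgroup (stab x) G"
    proof (rule subgroupI)
      show "stab x \<noteq> {}"
        using one[OF that] by (auto simp: stab_def)
      show "inv g \<in> stab x" if "g \<in> stab x" for g
        using that undo[of g x] \<open>x \<in> T\<close> by (simp add: stab_def)
      show "g \<otimes> h \<in> stab x" if "g \<in> stab x" "h \<in> stab x" for g h
        using that mult[of g h x] \<open>x \<in> T\<close> by (simp add: stab_def)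
    qed (simp add: stab_def)
    show "stab x \<noteq> carrier G"
      using fpf[OF that] by (auto simp: stab_def)
  qed
  have coset: "trans x (act g x) = g <# stab x" if "g \<in> carrier G" "x \<in> T" for g x
  proof
    show "trans x (act g x) \<subseteq> g <# stab x"
    proof
      fix h assume h: "h \<in> trans x (act g x)"
      then have "inv g \<otimes> h \<in> stab x" "h = g \<otimes> (inv g \<otimes> h)"
        using that by (auto simp: trans_def stab_def mult undo simp flip: m_assoc)
      then show "h \<in> g <# stab x"
        unfolding l_coset_image by (rule rev_image_eqI)
    qed
    show "g <# stab x \<subseteq> trans x (act g x)"
      using that by (auto simp: trans_def stab_def mult l_coset_image)
  qed
  have rT: "\<exists>g\<in>carrier G. r x \<in> T \<and> x = act g (r x)" if x: "x \<in> T" for x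
  proof -
    obtain g where "g \<in> carrier G" "r x = act g x"
      using r[of x] by (auto simp: orb_def)
    then show ?thesis
      using x undo closed by (intro bexI[of _ "inv g"]) auto
  qed
  show ?thesis
  proof (rule that[of e])
    fix x assume x: "x \<in> T"
    obtain g where g: "g \<in> carrier G" "r x \<in> T" "x = act g (r x)"
      using rT[OF x] by blast
    have e: "e x = (stab (r x), g <# stab (r x))"
      using g(3) coset[OF g(1,2)] by (simp add: e_def)
    then show "e x \<in> topspace (orbit_union G)"
      using stab[OF g(2)] g(1) by (auto simp: orbit_union_def LCOSETS_def)
    fix h assume h: "h \<in> carrier G"
    have "r (act h x) = r x"
      by (simp add: r_def orb_act[OF h x])
    moreover have "act h x = act (h \<otimes> g) (r x)"
      using g h mult by metis
    ultimately have "e (act h x) = (stab (r x), (h \<otimes> g) <# stab (r x))"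
      using coset[of "h \<otimes> g" "r x"] g h by (simp add: e_def)
    then show "e (act h x) = orbit_union_act G h (e x)"
      using stab[OF g(2)] g h by (simp add: e orbit_union_act_def lcos_m_assoc subgroup.subset)
  qed
qed

section \<open>The space of functions with few maxima\<close>

definition strict_top_set :: "('a \<Rightarrow> real) \<Rightarrow> 'a set \<Rightarrow> bool" where
  "strict_top_set y S \<longleftrightarrow> S \<subseteq> carrier G \<and> (\<forall>s\<in>S. \<forall>t\<in>carrier G - S. y t < y s)"

text \<open>Two strict top sets are comparable by inclusion: if both differences had elements, their values
  would have to lie strictly above each other.\<close>

lemma strict_top_set_unique:
  assumes "finite (carrier G)" "strict_top_set y S" "strict_top_set y S'" "card S = card S'"
  shows "S = S'"
proof (rule ccontr)
  assume ne: "S \<noteq> S'"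
  have fin: "finite S" "finite S'"
    using assms by (auto simp: strict_top_set_def intro: finite_subset)
  have "\<not> S \<subseteq> S'" "\<not> S' \<subseteq> S"
    using ne fin assms(4) by (metis card_subset_eq)+
  then obtain s s' where "s \<in> S - S'" "s' \<in> S' - S"
    by blast
  then have "y s' < y s" "y s < y s'"
    using assms(2,3) unfolding strict_top_set_def by blast+
  then show False
    by simp
qed

lemma strict_top_set_act:
  assumes "strict_top_set y S" "g \<in> carrier G"
  shows "strict_top_set (map_act G g y) (g <# S)"
  unfolding strict_top_set_def
proof (intro conjI ballI)
  have S: "S \<subseteq> carrier G"
    using assms(1) by (simp add: strict_top_set_def)
  show "g <# S \<subseteq> carrier G"
    using S assms(2) by (rule l_coset_subset_G)
  fix s t assume "s \<in> g <# S" and t: "t \<in> carrier G - (g <# S)"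
  then obtain h where h: "h \<in> S" "s = g \<otimes> h"
    by (auto simp: l_coset_image)
  have "t = g \<otimes> (inv g \<otimes> t)"
    using t assms(2) by (simp flip: m_assoc)
  then have "inv g \<otimes> t \<in> carrier G - S"
    using t assms(2) by (auto simp: l_coset_image)
  then have "y (inv g \<otimes> t) < y h"
    using assms(1) h(1) by (simp add: strict_top_set_def)
  moreover have "map_act G g y s = y h"
    unfolding h(2) by (rule translate_indices(3)[OF is_group assms(2) S h(1)])
  ultimately show "map_act G g y t < map_act G g y s"
    using t by (simp add: map_act_def)
qed

lemma card_l_coset: "S \<subseteq> carrier G \<Longrightarrow> g \<in> carrier G \<Longrightarrow> card (g <# S) = card S"
  unfolding l_coset_image by (rule translate_indices(2)[OF is_group])

text \<open>A nonempty set that is invariant under all left translations is the whole group, so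
  translation has no fixed point among the sets of a fixed cardinality strictly between \<open>0\<close> and
  the order of \<open>G\<close>.\<close>

lemma subsets_of_card_to_orbits:
  assumes "0 < n" "n < order G"
  obtains e where
    "\<And>S. S \<subseteq> carrier G \<Longrightarrow> card S = n \<Longrightarrow> e S \<in> topspace (orbit_union G)"
    "\<And>g S. g \<in> carrier G \<Longrightarrow> S \<subseteq> carrier G \<Longrightarrow> card S = n \<Longrightarrow>
       e (g <# S) = orbit_union_act G g (e S)"
proof (rule fixed_point_free_set_to_orbits[of "{S. S \<subseteq> carrier G \<and> card S = n}" "l_coset G"])
  fix S assume S: "S \<in> {S. S \<subseteq> carrier G \<and> card S = n}"
  show "\<one> <# S = S"
    using S by (simp add: lcos_mult_one)
  show "\<exists>g\<in>carrier G. g <# S \<noteq> S"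
  proof (rule ccontr)
    assume fixed: "\<not> (\<exists>g\<in>carrier G. g <# S \<noteq> S)"
    have "S \<noteq> {}"
      using S assms(1) by auto
    then obtain s where s: "s \<in> S" "s \<in> carrier G"
      using S by blast
    have "h \<in> S" if h: "h \<in> carrier G" for h
    proof -
      have "(h \<otimes> inv s) \<otimes> s \<in> (h \<otimes> inv s) <# S"
        unfolding l_coset_image using s(1) by (rule imageI)
      moreover have "(h \<otimes> inv s) \<otimes> s = h"
        using h s(2) by (simp add: m_assoc)
      moreover have "(h \<otimes> inv s) <# S = S"
        using fixed h s(2) by blast
      ultimately show ?thesis
        by simp
    qed
    then have "S = carrier G"
      using S by blast
    then show False
      using S assms(2) by (simp add: order_def)
  qed
  fix g assume g: "g \<in> carrier G"
  show "g <# S \<in> {S. S \<subseteq> carrier G \<and> card S = n}"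
    using S g by (simp add: card_l_coset l_coset_subset_G)
  fix h assume "h \<in> carrier G"
  then show "(g \<otimes> h) <# S = g <# (h <# S)"
    using S g by (simp add: lcos_m_assoc)
next
  fix e :: "'a set \<Rightarrow> 'a set \<times> 'a set"
  assume "\<And>S. S \<in> {S. S \<subseteq> carrier G \<and> card S = n} \<Longrightarrow> e S \<in> topspace (orbit_union G)"
    "\<And>g S. g \<in> carrier G \<Longrightarrow> S \<in> {S. S \<subseteq> carrier G \<and> card S = n} \<Longrightarrow>
       e (g <# S) = orbit_union_act G g (e S)"
  then show thesis
    by (intro that[of e]) simp_all
qed

text \<open>Finitely many strict inequalities between coordinates define an open set.\<close>

lemma openin_strict_top_set:
  assumes fin: "finite (carrier G)" and S: "S \<subseteq> carrier G"
  shows "openin (map_space G euclideanreal)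
           {y \<in> topspace (map_space G euclideanreal). strict_top_set y S}"
proof -
  let ?M = "map_space G euclideanreal"
  define P where "P = S \<times> (carrier G - S)"
  have "finite P"
    using fin S by (simp add: P_def finite_subset)
  moreover have "P \<subseteq> carrier G \<times> carrier G"
    using S by (auto simp: P_def)
  ultimately have "openin ?M {y \<in> topspace ?M. \<forall>(s, t)\<in>P. y t < y s}"
  proof (induction P rule: finite_induct)
    case (insert p P)
    obtain s t where p: "p = (s, t)" "s \<in> carrier G" "t \<in> carrier G"
      using insert.prems by auto
    have "continuous_map ?M euclideanreal (\<lambda>y. y s - y t)"
      unfolding map_space_def by (intro continuous_intros continuous_map_product_projection p)
    then have "openin ?M {y \<in> topspace ?M. y s - y t \<in> {0<..}}"
      by (rule openin_continuous_map_preimage) simp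
    with insert have "openin ?M ({y \<in> topspace ?M. y s - y t \<in> {0<..}} \<inter>
        {y \<in> topspace ?M. \<forall>(s, t)\<in>P. y t < y s})"
      by (intro openin_Int) auto
    also have "\<dots> = {y \<in> topspace ?M. \<forall>(s, t)\<in>insert p P. y t < y s}"
      by (auto simp: p(1))
    finally show ?case .
  qed simp
  then show ?thesis
    using S by (simp add: P_def strict_top_set_def)
qed

text \<open>The set of all maximum points serves as \<open>S\<close>.\<close>

lemma W_strict_top_set_ex:
  assumes fin: "finite (carrier G)" and y: "y \<in> topspace (W G k)"
  shows "\<exists>S. strict_top_set y S \<and> S \<noteq> {} \<and> card S < k"
proof -
  define S where "S = {s \<in> carrier G. \<forall>t\<in>carrier G. y t \<le> y s}"
  obtain s where s: "s \<in> carrier G" "y s = Max (y ` carrier G)"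
    using Max_in[of "y ` carrier G"] fin one_closed by fastforce
  then have max: "\<forall>t\<in>carrier G. y t \<le> y s"
    using fin by simp
  then have S_eq: "S = {t \<in> carrier G. y t = y s}"
    using s(1) by (force simp: S_def)
  have "card S < k"
  proof (rule ccontr)
    assume "\<not> card S < k"
    then obtain S' where "S' \<subseteq> S" "card S' = k"
      by (meson linorder_not_less obtain_subset_with_card_n)
    then have "y \<in> kdiag_max G k"
      using y max unfolding kdiag_max_def W_def S_eq by auto
    then show False
      using y by (simp add: W_def)
  qed
  moreover have "strict_top_set y S"
    using max unfolding strict_top_set_def S_eq by (force simp: less_le)
  ultimately show ?thesis
    using s max by (auto simp: S_eq)
qed

text \<open>By uniqueness the top set of cardinality \<open>n\<close> is a function of \<open>y\<close>. Its fibres are open, so it is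
  continuous into a discrete space, and composing it with a map to the orbits gives the chart.\<close>

lemma orbit_chart_strict_top_set:
  assumes fin: "finite (carrier G)" and n: "0 < n" "n < order G"
  shows "orbit_chart G (map_space G euclideanreal) (map_act G)
           {y \<in> topspace (map_space G euclideanreal). \<exists>S. strict_top_set y S \<and> card S = n}"
proof -
  let ?M = "map_space G euclideanreal :: ('a \<Rightarrow> real) topology"
  define U where "U = {y \<in> topspace ?M. \<exists>S. strict_top_set y S \<and> card S = n}"
  define l where "l y = (THE S. strict_top_set y S \<and> card S = n)" for y
  have l_eq: "l y = S" if "strict_top_set y S" "card S = n" for y S
    unfolding l_def using that strict_top_set_unique[OF fin] by (intro the_equality) auto
  have l: "y \<in> topspace ?M" "strict_top_set y (l y)" "card (l y) = n" "l y \<subseteq> carrier G"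
    if "y \<in> U" for y
    using that l_eq by (auto simp: U_def strict_top_set_def)
  have l_act: "map_act G g y \<in> U \<and> l (map_act G g y) = g <# l y"
    if g: "g \<in> carrier G" and y: "y \<in> U" for g y
  proof -
    have S: "strict_top_set (map_act G g y) (g <# l y)" "card (g <# l y) = n"
      using strict_top_set_act[OF l(2)[OF y] g] card_l_coset[OF l(4)[OF y] g] l(3)[OF y] by simp_all
    moreover have "map_act G g y \<in> topspace ?M"
      by (rule map_act_in_space[OF is_group g l(1)[OF y]])
    ultimately show ?thesis
      using l_eq[OF S] unfolding U_def by blast
  qed
  have label_open: "openin ?M {y \<in> U. l y \<in> A}" for A
  proof -
    have "openin ?M (\<Union>S\<in>{S \<in> A. S \<subseteq> carrier G \<and> card S = n}. {y \<in> topspace ?M. strict_top_set y S})"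
      using openin_strict_top_set[OF fin] by (intro openin_Union) auto
    also have "(\<Union>S\<in>{S \<in> A. S \<subseteq> carrier G \<and> card S = n}. {y \<in> topspace ?M. strict_top_set y S})
        = {y \<in> U. l y \<in> A}"
    proof (rule subset_antisym)
      show "{y \<in> U. l y \<in> A}
          \<subseteq> (\<Union>S\<in>{S \<in> A. S \<subseteq> carrier G \<and> card S = n}. {y \<in> topspace ?M. strict_top_set y S})"
        using l by blast
    qed (auto simp: U_def l_eq)
    finally show ?thesis .
  qed
  have U_open: "openin ?M U"
    using label_open[of UNIV] by simp
  obtain e where e: "\<And>S. S \<subseteq> carrier G \<Longrightarrow> card S = n \<Longrightarrow> e S \<in> topspace (orbit_union G)"
    "\<And>g S. g \<in> carrier G \<Longrightarrow> S \<subseteq> carrier G \<Longrightarrow> card S = n \<Longrightarrow>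
       e (g <# S) = orbit_union_act G g (e S)"
    using subsets_of_card_to_orbits[OF n] by metis
  have top: "topspace (subtopology ?M U) = U"
    using openin_subset[OF U_open] by (rule topspace_subtopology_subset)
  have "continuous_map (subtopology ?M U) (orbit_union G) (e \<circ> l)"
    unfolding continuous_map_def top
  proof (intro conjI allI impI)
    show "e \<circ> l \<in> U \<rightarrow> topspace (orbit_union G)"
      using e(1) l(3,4) by simp
    fix A
    have "openin ?M {y \<in> U. (e \<circ> l) y \<in> A}"
      using label_open[of "{S. e S \<in> A}"] by simp
    then show "openin (subtopology ?M U) {y \<in> U. (e \<circ> l) y \<in> A}"
      using U_open by (simp add: openin_open_subtopology)
  qed
  moreover have "(e \<circ> l) (map_act G g y) = orbit_union_act G g ((e \<circ> l) y)"
    if "g \<in> carrier G" "y \<in> U" for g y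
    using l_act[OF that] e(2)[OF that(1) l(4,3)[OF that(2)]] by simp
  ultimately have "equivariant_map G (subtopology ?M U) (map_act G)
      (orbit_union G) (orbit_union_act G) (e \<circ> l)"
    unfolding equivariant_map_def top by blast
  then have "orbit_chart G ?M (map_act G) U"
    unfolding orbit_chart_def using U_open l_act by blast
  then show ?thesis
    by (simp only: U_def)
qed

text \<open>The charts for \<open>n = 1, \<dots>, k - 1\<close>, restricted to \<open>W\<close>; their indices are shifted to start at
  \<open>0\<close>.\<close>

lemma W_genus_le:
  assumes fin: "finite (carrier G)" and k: "k \<le> order G"
  shows "fpf_genus_le G (W G k) (map_act G) (k - 1)"
proof -
  let ?M = "map_space G euclideanreal :: ('a \<Rightarrow> real) topology"
  define U where "U n = {y \<in> topspace ?M. \<exists>S. strict_top_set y S \<and> card S = n}" for n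
  have "equivariant_map G (W G k) (map_act G) ?M (map_act G) (\<lambda>y. y)"
    by (simp add: equivariant_map_def W_def continuous_map_from_subtopology)
  note chart = orbit_chart_preimage[OF this G_space_act_closed[OF W_fixed_point_free(1)[OF is_group k]]]
  have "orbit_chart G (W G k) (map_act G) {y \<in> topspace (W G k). y \<in> U (Suc i)}" if "i < k - 1" for i
    using that k by (intro chart) (simp_all add: U_def orbit_chart_strict_top_set[OF fin])
  moreover have "\<exists>i<k - 1. y \<in> U (Suc i)" if y: "y \<in> topspace (W G k)" for y
  proof -
    obtain S where S: "strict_top_set y S" "S \<noteq> {}" "card S < k"
      using W_strict_top_set_ex[OF fin y] by blast
    then have "card S > 0"
      using fin by (auto simp: strict_top_set_def card_gt_0_iff intro: finite_subset[OF _ fin])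
    moreover have "y \<in> U (card S)"
      using S(1) y by (auto simp: U_def W_def)
    ultimately show ?thesis
      using S(3) by (intro exI[of _ "card S - 1"]) auto
  qed
  then have "topspace (W G k) = (\<Union>i<k - 1. {y \<in> topspace (W G k). y \<in> U (Suc i)})"
    by blast
  ultimately show ?thesis
    unfolding fpf_genus_le_iff_charts
    by (intro exI[of _ "\<lambda>i. {y \<in> topspace (W G k). y \<in> U (Suc i)}"]) blast
qed

section \<open>Configuration spaces\<close>

lemma equivariant_map_space:
  assumes "continuous_map Y Z f"
  shows "equivariant_map G (map_space G Y) (map_act G) (map_space G Z) (map_act G)
           (\<lambda>\<phi>. \<lambda>h\<in>carrier G. f (\<phi> h))"
  unfolding equivariant_map_def
proof (intro conjI ballI)
  show "continuous_map (map_space G Y) (map_space G Z) (\<lambda>\<phi>. \<lambda>h\<in>carrier G. f (\<phi> h))"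
    unfolding map_space_def
  proof (subst continuous_map_componentwise, intro conjI ballI)
    fix h assume h: "h \<in> carrier G"
    have "continuous_map (product_topology (\<lambda>_. Y) (carrier G)) Z (f \<circ> (\<lambda>\<phi>. \<phi> h))"
      using continuous_map_product_projection[OF h] assms by (rule continuous_map_compose)
    then show "continuous_map (product_topology (\<lambda>_. Y) (carrier G)) Z
        (\<lambda>\<phi>. (\<lambda>h\<in>carrier G. f (\<phi> h)) h)"
      using h by (simp add: o_def)
  qed auto
qed (auto simp: map_act_def fun_eq_iff)

text \<open>In a Hausdorff space equality of two coordinates is a closed condition; the diagonal is the
  union, over the finitely many index sets, of intersections of such conditions.\<close>

lemma closedin_kdiag:
  assumes fin: "finite (carrier G)" and Y: "Hausdorff_space Y"
  shows "closedin (map_space G Y) (kdiag G k Y)"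
proof -
  let ?M = "map_space G Y"
  have eq: "closedin ?M {y \<in> topspace ?M. y i = y j}" if "i \<in> carrier G" "j \<in> carrier G" for i j
    unfolding map_space_def
    by (intro closedin_continuous_maps_eq[OF Y] continuous_map_product_projection that)
  have "closedin ?M (topspace ?M \<inter> (\<Inter>(i,j)\<in>S \<times> S. {y \<in> topspace ?M. y i = y j}))"
    if "S \<subseteq> carrier G" for S
  proof (cases "S = {}")
    case False
    then show ?thesis
      using eq that by (intro closedin_Int closedin_topspace closedin_Inter) auto
  qed auto
  then have "closedin ?M (\<Union>S\<in>{S. S \<subseteq> carrier G \<and> card S = k}.
      topspace ?M \<inter> (\<Inter>(i,j)\<in>S \<times> S. {y \<in> topspace ?M. y i = y j}))"
    using fin by (intro closedin_Union) auto
  also have "(\<Union>S\<in>{S. S \<subseteq> carrier G \<and> card S = k}.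
      topspace ?M \<inter> (\<Inter>(i,j)\<in>S \<times> S. {y \<in> topspace ?M. y i = y j})) = kdiag G k Y"
    unfolding kdiag_def by auto
  finally show ?thesis .
qed

lemma openin_off_kdiag:
  assumes "finite (carrier G)" "Hausdorff_space Y" and f: "continuous_map X (map_space G Y) f"
  shows "openin X {x \<in> topspace X. f x \<notin> kdiag G j Y}"
proof -
  have "openin X {x \<in> topspace X. f x \<in> topspace (map_space G Y) - kdiag G j Y}"
    using closedin_kdiag[OF assms(1,2)]
    by (intro openin_continuous_map_preimage[OF f] openin_diff openin_topspace)
  also have "{x \<in> topspace X. f x \<in> topspace (map_space G Y) - kdiag G j Y}
      = {x \<in> topspace X. f x \<notin> kdiag G j Y}"
    using continuous_map_funspace[OF f] by auto
  finally show ?thesis .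
qed

lemma off_kdiag_act:
  assumes f: "equivariant_map G X act (map_space G Y) (map_act G) f"
    and g: "g \<in> carrier G" and x: "x \<in> topspace X" "f x \<notin> kdiag G j Y"
  shows "f (act g x) \<notin> kdiag G j Y"
proof
  assume "f (act g x) \<in> kdiag G j Y"
  then have "map_act G g (f x) \<in> kdiag G j Y"
    using f g x(1) by (simp add: equivariant_map_def)
  then have "map_act G (inv g) (map_act G g (f x)) \<in> kdiag G j Y"
    by (rule map_act_kdiag[OF is_group inv_closed[OF g]])
  moreover have "f x \<in> topspace (map_space G Y)"
    using f x(1) continuous_map_funspace[of X "map_space G Y" f] by (auto simp: equivariant_map_def)
  ultimately show False
    using map_act_inverse[OF is_group g, of "f x" Y] x(2) by simp
qed

lemma kdiag_max_subset: "kdiag_max G k \<subseteq> kdiag G k euclideanreal"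
  unfolding kdiag_max_def kdiag_def by fastforce

lemma Hausdorff_Euclidean_space: "Hausdorff_space (Euclidean_space n)"
  unfolding Euclidean_space_def
  by (intro Hausdorff_space_subtopology) (simp add: Hausdorff_space_product_topology)

lemma continuous_map_Euclidean_space_coord: "continuous_map (Euclidean_space n) euclideanreal (\<lambda>x. x i)"
  unfolding Euclidean_space_def
  by (intro continuous_map_from_subtopology continuous_map_product_projection) simp

lemma continuous_map_Euclidean_space_shift:
  "continuous_map (Euclidean_space n) (Euclidean_space (n - 1)) (\<lambda>x i. x (Suc i))"
proof -
  have "continuous_map (Euclidean_space n) (powertop_real UNIV) (\<lambda>x i. x (Suc i))"
    by (simp add: continuous_map_componentwise_UNIV continuous_map_Euclidean_space_coord)
  then show ?thesis
    unfolding Euclidean_space_def[of "n - 1"] continuous_map_in_subtopology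
    by (auto simp: topspace_Euclidean_space)
qed

definition first_coord :: "('a \<Rightarrow> nat \<Rightarrow> real) \<Rightarrow> 'a \<Rightarrow> real" where
  "first_coord \<phi> = (\<lambda>h\<in>carrier G. \<phi> h 0)"

definition other_coords :: "('a \<Rightarrow> nat \<Rightarrow> real) \<Rightarrow> 'a \<Rightarrow> nat \<Rightarrow> real" where
  "other_coords \<phi> = (\<lambda>h\<in>carrier G. \<lambda>i. \<phi> h (Suc i))"

lemma equivariant_first_coord:
  "equivariant_map G (map_space G (Euclidean_space m)) (map_act G)
     (map_space G euclideanreal) (map_act G) first_coord"
  using equivariant_map_space[OF continuous_map_Euclidean_space_coord]
  by (simp add: first_coord_def[abs_def])

lemma equivariant_other_coords:
  "equivariant_map G (map_space G (Euclidean_space m)) (map_act G)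
     (map_space G (Euclidean_space (m - 1))) (map_act G) other_coords"
  using equivariant_map_space[OF continuous_map_Euclidean_space_shift]
  by (simp add: other_coords_def[abs_def])

lemma V\<^sub>1_eq:
  "V\<^sub>1 G m k = subtopology (map_space G (Euclidean_space m))
     (- {\<phi>. first_coord \<phi> \<in> kdiag G k euclideanreal \<and>
             other_coords \<phi> \<in> kdiag G (order G) (Euclidean_space (m - 1))})"
  by (simp add: V\<^sub>1_def first_coord_def other_coords_def)

lemma other_coords_kdiag_order:
  assumes "finite (carrier G)" "other_coords \<phi> \<in> kdiag G (order G) Y"
    and "h \<in> carrier G" "h' \<in> carrier G"
  shows "\<phi> h (Suc i) = \<phi> h' (Suc i)"
proof -
  obtain S where S: "S \<subseteq> carrier G" "card S = order G"
      "\<forall>a\<in>S. \<forall>b\<in>S. other_coords \<phi> a = other_coords \<phi> b"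
    using assms(2) unfolding kdiag_def by blast
  then have "S = carrier G"
    using assms(1) by (simp add: card_subset_eq order_def)
  then have "other_coords \<phi> h = other_coords \<phi> h'"
    using S(3) assms(3,4) by blast
  then have "other_coords \<phi> h i = other_coords \<phi> h' i"
    by (rule fun_cong)
  then show ?thesis
    using assms(3,4) by (simp add: other_coords_def)
qed

text \<open>If all coordinates but the first are constant on \<open>G\<close>, coincidences of the first coordinate are
  coincidences of points. This applies both to dimension \<open>1\<close>, where the others vanish, and to the
  complement of \<open>V\<^sub>1\<close>.\<close>

lemma kdiag_of_coords:
  assumes \<phi>: "\<phi> \<in> topspace (map_space G (Euclidean_space m))"
    and first: "first_coord \<phi> \<in> kdiag G k euclideanreal"
    and others: "\<And>h h' i. h \<in> carrier G \<Longrightarrow> h' \<in> carrier G \<Longrightarrow> \<phi> h (Suc i) = \<phi> h' (Suc i)"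
  shows "\<phi> \<in> kdiag G k (Euclidean_space m)"
proof -
  obtain S where S: "S \<subseteq> carrier G" "card S = k"
      "\<forall>a\<in>S. \<forall>b\<in>S. first_coord \<phi> a = first_coord \<phi> b"
    using first unfolding kdiag_def by blast
  have "\<phi> a i = \<phi> b i" if "a \<in> S" "b \<in> S" for a b i
  proof (cases i)
    case 0
    have "first_coord \<phi> a = first_coord \<phi> b"
      using S(3) that by blast
    then show ?thesis
      using 0 that S(1) by (auto simp: first_coord_def subset_iff)
  next
    case (Suc j)
    then show ?thesis
      using others that S(1) by (auto simp: subset_iff)
  qed
  then show ?thesis
    using \<phi> S(1,2) unfolding kdiag_def by blast
qed

lemma V_1_genus_le_W:
  assumes "k \<le> order G"
  shows "fpf_genus G (V G 1 k) (map_act G) \<le> fpf_genus G (W G k) (map_act G)"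
proof (rule fpf_genus_mono[OF _ G_space_act_closed[OF V_fixed_point_free(1)[OF is_group assms]]])
  show "equivariant_map G (V G 1 k) (map_act G) (W G k) (map_act G) first_coord"
    unfolding V_def W_def
  proof (rule equivariant_map_subspaces[OF equivariant_first_coord])
    fix \<phi> assume \<phi>: "\<phi> \<in> topspace (map_space G (Euclidean_space 1))"
      "\<phi> \<in> - kdiag G k (Euclidean_space 1)"
    have "\<phi> h (Suc i) = 0" if "h \<in> carrier G" for h i
      using \<phi>(1) that by (force simp: map_space_def topspace_Euclidean_space)
    then show "first_coord \<phi> \<in> - kdiag_max G k"
      using kdiag_of_coords[OF \<phi>(1)] \<phi>(2) kdiag_max_subset by (metis Compl_iff subsetD)
  qed
qed

lemma V_genus_le_V\<^sub>1:
  assumes "finite (carrier G)" "k \<le> order G"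
  shows "fpf_genus G (V G m k) (map_act G) \<le> fpf_genus G (V\<^sub>1 G m k) (map_act G)"
proof (rule fpf_genus_mono[OF _ G_space_act_closed[OF V_fixed_point_free(1)[OF is_group assms(2)]]])
  have "equivariant_map G (map_space G (Euclidean_space m)) (map_act G)
      (map_space G (Euclidean_space m)) (map_act G) (\<lambda>\<phi>. \<phi>)"
    by (simp add: equivariant_map_def)
  then show "equivariant_map G (V G m k) (map_act G) (V\<^sub>1 G m k) (map_act G) (\<lambda>\<phi>. \<phi>)"
    unfolding V_def V\<^sub>1_eq
  proof (rule equivariant_map_subspaces)
    fix \<phi> assume \<phi>: "\<phi> \<in> topspace (map_space G (Euclidean_space m))"
      "\<phi> \<in> - kdiag G k (Euclidean_space m)"
    have "other_coords \<phi> \<notin> kdiag G (order G) (Euclidean_space (m - 1))"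
      if "first_coord \<phi> \<in> kdiag G k euclideanreal"
    proof
      assume "other_coords \<phi> \<in> kdiag G (order G) (Euclidean_space (m - 1))"
      then have "\<phi> \<in> kdiag G k (Euclidean_space m)"
        by (intro kdiag_of_coords[OF \<phi>(1) that] other_coords_kdiag_order[OF assms(1)])
      then show False
        using \<phi>(2) by simp
    qed
    then show "\<phi> \<in> - {\<phi>. first_coord \<phi> \<in> kdiag G k euclideanreal \<and>
        other_coords \<phi> \<in> kdiag G (order G) (Euclidean_space (m - 1))}"
      by simp
  qed
qed

text \<open>Removing a product of two diagonals leaves the union of the two sets where one of the factors is
  avoided. Avoiding the \<open>k\<close>-wise diagonal in the first coordinate puts this coordinate in \<open>W\<close>, and avoiding the
  \<open>q\<close>-wise diagonal in the others puts these in \<open>V(m-1,q,q)\<close>.\<close>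

lemma V\<^sub>1_genus_le:
  assumes fin: "finite (carrier G)" and k: "k \<le> order G"
  shows "fpf_genus G (V\<^sub>1 G m k) (map_act G)
           \<le> fpf_genus G (V G (m - 1) (order G)) (map_act G) + enat (k - 1)"
proof (cases "fpf_genus G (V G (m - 1) (order G)) (map_act G) = \<infinity>")
  case False
  then obtain n where n: "fpf_genus G (V G (m - 1) (order G)) (map_act G) = enat n"
      "fpf_genus_le G (V G (m - 1) (order G)) (map_act G) n"
    by (rule fpf_genus_finite_obtain)
  let ?M = "map_space G (Euclidean_space m)" and ?D = "kdiag G k euclideanreal"
    and ?E = "kdiag G (order G) (Euclidean_space (m - 1))"
  define A where "A = {\<phi> \<in> topspace ?M. first_coord \<phi> \<notin> ?D}"
  define B where "B = {\<phi> \<in> topspace ?M. other_coords \<phi> \<notin> ?E}"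
  have top: "topspace (V\<^sub>1 G m k) = B \<union> A"
    by (auto simp: V\<^sub>1_eq A_def B_def)
  have first: "continuous_map ?M (map_space G euclideanreal) first_coord"
    and others: "continuous_map ?M (map_space G (Euclidean_space (m - 1))) other_coords"
    using equivariant_first_coord[of m] equivariant_other_coords[of m]
    by (simp_all only: equivariant_map_def)
  have open_A: "openin ?M A"
    unfolding A_def by (rule openin_off_kdiag[OF fin _ first]) simp
  have open_B: "openin ?M B"
    unfolding B_def by (rule openin_off_kdiag[OF fin Hausdorff_Euclidean_space others])
  have act_A: "map_act G g \<phi> \<in> A" if "g \<in> carrier G" "\<phi> \<in> A" for g \<phi>
    using that map_act_in_space[OF is_group that(1), of \<phi>]
      off_kdiag_act[OF equivariant_first_coord that(1), of \<phi> m] by (simp add: A_def)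
  have act_B: "map_act G g \<phi> \<in> B" if "g \<in> carrier G" "\<phi> \<in> B" for g \<phi>
    using that map_act_in_space[OF is_group that(1), of \<phi>]
      off_kdiag_act[OF equivariant_other_coords that(1), of \<phi> m] by (simp add: B_def)
  have map_A: "equivariant_map G (subtopology ?M A) (map_act G) (W G k) (map_act G) first_coord"
    unfolding W_def
  proof (rule equivariant_map_subspaces[OF equivariant_first_coord])
    fix \<phi> assume "\<phi> \<in> A"
    then show "first_coord \<phi> \<in> - kdiag_max G k"
      using kdiag_max_subset[of k] by (auto simp: A_def)
  qed
  have map_B: "equivariant_map G (subtopology ?M B) (map_act G)
      (V G (m - 1) (order G)) (map_act G) other_coords"
    unfolding V_def
  proof (rule equivariant_map_subspaces[OF equivariant_other_coords])
    fix \<phi> assume "\<phi> \<in> B"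
    then show "other_coords \<phi> \<in> - ?E"
      by (simp add: B_def)
  qed
  have "fpf_genus_le G (subtopology ?M A) (map_act G) (k - 1)"
  proof (rule fpf_genus_le_pullback[OF map_A _ W_genus_le[OF fin k]])
    show "map_act G g \<phi> \<in> topspace (subtopology ?M A)"
      if "g \<in> carrier G" "\<phi> \<in> topspace (subtopology ?M A)" for g \<phi>
      using that act_A[of g \<phi>] topspace_subtopology_subset[OF openin_subset[OF open_A]] by simp
  qed
  moreover have "fpf_genus_le G (subtopology ?M B) (map_act G) n"
  proof (rule fpf_genus_le_pullback[OF map_B _ n(2)])
    show "map_act G g \<phi> \<in> topspace (subtopology ?M B)"
      if "g \<in> carrier G" "\<phi> \<in> topspace (subtopology ?M B)" for g \<phi>
      using that act_B[of g \<phi>] topspace_subtopology_subset[OF openin_subset[OF open_B]] by simp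
  qed
  \<comment> \<open>\<open>A\<close> and \<open>B\<close> were studied as subspaces of the full power; they carry the same structure in \<open>V\<^sub>1\<close>.\<close>
  moreover have "openin (V\<^sub>1 G m k) C \<and> subtopology (V\<^sub>1 G m k) C = subtopology ?M C"
    if C: "openin ?M C" "C \<subseteq> topspace (V\<^sub>1 G m k)" for C
  proof -
    define N where "N = - {\<phi>. first_coord \<phi> \<in> ?D \<and> other_coords \<phi> \<in> ?E}"
    have V\<^sub>1: "V\<^sub>1 G m k = subtopology ?M N"
      unfolding V\<^sub>1_eq N_def by (rule refl)
    have "C \<inter> N = C" "N \<inter> C = C"
      using C(2) unfolding V\<^sub>1 by auto
    then show ?thesis
      using openin_subtopology_Int[OF C(1), of N] by (simp add: V\<^sub>1 subtopology_subtopology)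
  qed
  ultimately have "fpf_genus_le G (V\<^sub>1 G m k) (map_act G) (n + (k - 1))"
    using open_A open_B top by (intro fpf_genus_le_Un[of _ B A]) simp_all
  from fpf_genus_leI[OF this] show ?thesis
    unfolding n(1) by simp
qed simp

text \<open>Each additional dimension costs \<open>q - 1\<close>, the price of \<open>W(q,q)\<close>. In dimension \<open>0\<close> all maps are
  constant and \<open>V\<close> is empty.\<close>

lemma V_order_genus_le:
  assumes fin: "finite (carrier G)"
  shows "fpf_genus G (V G m (order G)) (map_act G) \<le> enat (m * (order G - 1))"
proof (induction m)
  case 0
  have "\<phi> \<in> kdiag G (order G) (Euclidean_space 0)"
    if \<phi>: "\<phi> \<in> topspace (map_space G (Euclidean_space 0))" for \<phi>
    by (rule const_kdiag[OF order_refl \<phi>, where c = "\<lambda>_. 0"])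
      (use \<phi> in \<open>force simp: map_space_def topspace_Euclidean_space\<close>)
  then have "topspace (V G 0 (order G)) = {}"
    by (auto simp: V_def)
  then have "fpf_genus_le G (V G 0 (order G)) (map_act G) 0"
    by (simp add: fpf_genus_le_def)
  from fpf_genus_leI[OF this] show ?case
    by simp
next
  case (Suc m)
  have "fpf_genus G (V G (Suc m) (order G)) (map_act G)
      \<le> fpf_genus G (V\<^sub>1 G (Suc m) (order G)) (map_act G)"
    by (rule V_genus_le_V\<^sub>1[OF fin order_refl])
  also have "\<dots> \<le> fpf_genus G (V G m (order G)) (map_act G) + enat (order G - 1)"
    using V\<^sub>1_genus_le[OF fin order_refl, of "Suc m"] by simp
  also have "\<dots> \<le> enat (m * (order G - 1)) + enat (order G - 1)"
    by (rule add_right_mono[OF Suc.IH])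
  finally show ?case
    by (simp add: add.commute)
qed

end

theorem theorem5p2:
  fixes G :: "('a, 'b) monoid_scheme" and q m k :: nat
  assumes "Group.group G" and "finite (carrier G)" and "q = order G"
    and "m \<ge> 1" and "2 \<le> k" and "k \<le> q"
  shows "fpf_genus G (V G 1 k) (map_act G) \<le> fpf_genus G (W G k) (map_act G) \<and>
         fpf_genus G (W G k) (map_act G) \<le> enat (k - 1) \<and>
         fpf_genus G (V G m k) (map_act G) \<le> fpf_genus G (V\<^sub>1 G m k) (map_act G) \<and>
         fpf_genus G (V\<^sub>1 G m k) (map_act G)
           \<le> fpf_genus G (V G (m - 1) q) (map_act G) + enat (k - 1) \<and>
         fpf_genus G (V G (m - 1) q) (map_act G) + enat (k - 1)
           \<le> enat ((m - 1) * (q - 1) + (k - 1))"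
proof -
  interpret group G by fact
  have k: "k \<le> order G"
    using assms by simp
  have "fpf_genus G (V G (m - 1) q) (map_act G) + enat (k - 1)
      \<le> enat ((m - 1) * (q - 1)) + enat (k - 1)"
    using V_order_genus_le[OF assms(2)] assms(3) by (intro add_right_mono) simp
  then show ?thesis
    using V_1_genus_le_W[OF k] fpf_genus_leI[OF W_genus_le[OF assms(2) k]]
      V_genus_le_V\<^sub>1[OF assms(2) k] V\<^sub>1_genus_le[OF assms(2) k]
    by (simp add: assms(3))
qed

end
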